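(* Let $G$ be a $3$-edge-colorable cubic graph. If $G$ contains a $3$-cycle, then $G$ is not $\mathbb{Z}_4$-flow-connected, and hence not $4$-flow-connected.
   Context: Graphs are finite. A cycle is a connected 2-regular graph. Fix an arbitrary orientation $D$ of $G$; for a vertex $v$ let $E_D^+(v)$ and $E_D^-(v)$ be the sets of edges directed out of and into $v$. For an abelian group $A$, an $A$-flow on $G$ (always nowhere-zero here) is a function $f:E(G)\to A\setminus\{0_A\}$ with $\sum_{e\in E_D^+(v)}f(e)-\sum_{e\in E_D^-(v)}f(e)=0_A$ for every vertex $v$. For a positive integer $k$, a $k$-flow is a function $f:E(G)\to\mathbb{Z}$ satisfying the same conservation condition and $0<|f(e)|<k$ for all edges $e$. (Flows given with different orientations are identified by negating the value of every edge whose orientation is reversed, so the choice of $D$ does not matter.) Two $A$-flows (resp. $k$-flows) $f',f''$ are adjacent if there is a cycle $C$ in $G$ such that $f'(e)=f''(e)$ for all $e\notin E(C)$. Two $A$-flows (resp. $k$-flows) are equivalent if there is a finite sequence of $A$-flows (resp. $k$-flows) from one to the other in which consecutive flows are adjacent. $G$ is $A$-flow-connected (resp. $k$-flow-connected) if all its $A$-flows (resp. $k$-flows) are pairwise equivalent. *)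

theory Defs
  imports Main "HOL-Library.Multiset" "HOL-Library.FuncSet" "HOL-Library.Numeral_Type"
    "Graph_Theory.Digraph"
begin

text \<open>Parallel edges and loops are allowed; a loop at \<open>v\<close> has ends \<open>{#v, v#}\<close>.\<close>

record ('v, 'e) mgraph =
  nodes :: "'v set"
  edges :: "'e set"
  ends :: "'e \<Rightarrow> 'v multiset"

definition finite_graph :: "('v, 'e) mgraph \<Rightarrow> bool" where
  "finite_graph G \<longleftrightarrow> finite (nodes G) \<and> finite (edges G) \<and>
     (\<forall>e \<in> edges G. size (ends G e) = 2 \<and> set_mset (ends G e) \<subseteq> nodes G)"

text \<open>Using multiplicities, a loop contributes 2 to the degree.\<close>

definition degree :: "('v, 'e) mgraph \<Rightarrow> 'v \<Rightarrow> nat" where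
  "degree G v = (\<Sum>e \<in> edges G. count (ends G e) v)"

definition regular :: "nat \<Rightarrow> ('v, 'e) mgraph \<Rightarrow> bool" where
  "regular r G \<longleftrightarrow> (\<forall>v \<in> nodes G. degree G v = r)"

abbreviation cubic :: "('v, 'e) mgraph \<Rightarrow> bool" where
  "cubic G \<equiv> regular 3 G"

definition neighbours :: "('v, 'e) mgraph \<Rightarrow> ('v \<times> 'v) set" where
  "neighbours G = {(u, v). \<exists>e \<in> edges G. ends G e = {#u, v#}}"

definition connected_graph :: "('v, 'e) mgraph \<Rightarrow> bool" where
  "connected_graph G \<longleftrightarrow> nodes G \<noteq> {} \<and>
     (\<forall>u \<in> nodes G. \<forall>v \<in> nodes G. (u, v) \<in> (neighbours G)\<^sup>*)"

definition subgraph_of :: "('v, 'e) mgraph \<Rightarrow> ('v, 'e) mgraph \<Rightarrow> bool" where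
  "subgraph_of H G \<longleftrightarrow> finite_graph H \<and> nodes H \<subseteq> nodes G \<and> edges H \<subseteq> edges G \<and>
     (\<forall>e \<in> edges H. ends H e = ends G e)"

definition is_cycle :: "('v, 'e) mgraph \<Rightarrow> bool" where
  "is_cycle C \<longleftrightarrow> finite_graph C \<and> connected_graph C \<and> regular 2 C"

definition cycle_in :: "('v, 'e) mgraph \<Rightarrow> ('v, 'e) mgraph \<Rightarrow> bool" where
  "cycle_in C G \<longleftrightarrow> is_cycle C \<and> subgraph_of C G"

definition contains_cycle_of_length :: "('v, 'e) mgraph \<Rightarrow> nat \<Rightarrow> bool" where
  "contains_cycle_of_length G n \<longleftrightarrow> (\<exists>C. cycle_in C G \<and> card (nodes C) = n)"

text \<open>A loop is adjacent to itself, so a graph with a loop has no proper edge-colouring.\<close>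

definition edge_colourable :: "nat \<Rightarrow> ('v, 'e) mgraph \<Rightarrow> bool" where
  "edge_colourable k G \<longleftrightarrow> (\<forall>e \<in> edges G. \<forall>v. ends G e \<noteq> {#v, v#}) \<and>
     (\<exists>c :: 'e \<Rightarrow> nat. (\<forall>e \<in> edges G. c e < k) \<and>
       (\<forall>e \<in> edges G. \<forall>e' \<in> edges G.
          e \<noteq> e' \<and> set_mset (ends G e) \<inter> set_mset (ends G e') \<noteq> {} \<longrightarrow> c e \<noteq> c e'))"

definition orientation :: "('v, 'e) mgraph \<Rightarrow> ('v, 'e) pre_digraph \<Rightarrow> bool" where
  "orientation G D \<longleftrightarrow> verts D = nodes G \<and> arcs D = edges G \<and>
     (\<forall>e \<in> edges G. ends G e = {#tail D e, head D e#})"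

definition conserved :: "('v, 'e) pre_digraph \<Rightarrow> ('e \<Rightarrow> 'a::ab_group_add) \<Rightarrow> bool" where
  "conserved D f \<longleftrightarrow> (\<forall>v \<in> verts D. (\<Sum>e \<in> out_arcs D v. f e) - (\<Sum>e \<in> in_arcs D v. f e) = 0)"

text \<open>Flows are functions on the edge set, i.e. extensional outside of it. The abelian group
  \<open>A\<close> is given by a type of class \<open>ab_group_add\<close>; \<open>\<int>\<^sub>4\<close> is the type \<open>4\<close>.\<close>

definition group_flows :: "('v, 'e) pre_digraph \<Rightarrow> ('e \<Rightarrow> 'a::ab_group_add) set" where
  "group_flows D = {f \<in> arcs D \<rightarrow>\<^sub>E (UNIV - {0}). conserved D f}"

definition int_flows :: "nat \<Rightarrow> ('v, 'e) pre_digraph \<Rightarrow> ('e \<Rightarrow> int) set" where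
  "int_flows k D = {f \<in> arcs D \<rightarrow>\<^sub>E {i. 0 < \<bar>i\<bar> \<and> \<bar>i\<bar> < int k}. conserved D f}"

definition adjacent_flows :: "('v, 'e) mgraph \<Rightarrow> ('e \<Rightarrow> 'a) \<Rightarrow> ('e \<Rightarrow> 'a) \<Rightarrow> bool" where
  "adjacent_flows G f g \<longleftrightarrow> (\<exists>C. cycle_in C G \<and> (\<forall>e \<in> edges G - edges C. f e = g e))"

definition equivalent_flows ::
    "('v, 'e) mgraph \<Rightarrow> ('e \<Rightarrow> 'a) set \<Rightarrow> ('e \<Rightarrow> 'a) \<Rightarrow> ('e \<Rightarrow> 'a) \<Rightarrow> bool" where
  "equivalent_flows G F f g \<longleftrightarrow>
     (f, g) \<in> {(f', f''). f' \<in> F \<and> f'' \<in> F \<and> adjacent_flows G f' f''}\<^sup>*"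

definition group_flow_connected ::
    "'a::ab_group_add itself \<Rightarrow> ('v, 'e) mgraph \<Rightarrow> ('v, 'e) pre_digraph \<Rightarrow> bool" where
  "group_flow_connected A G D \<longleftrightarrow>
     (\<forall>f \<in> group_flows D. \<forall>g \<in> group_flows D.
        equivalent_flows G (group_flows D :: ('e \<Rightarrow> 'a) set) f g)"

definition int_flow_connected ::
    "nat \<Rightarrow> ('v, 'e) mgraph \<Rightarrow> ('v, 'e) pre_digraph \<Rightarrow> bool" where
  "int_flow_connected k G D \<longleftrightarrow>
     (\<forall>f \<in> int_flows k D. \<forall>g \<in> int_flows k D. equivalent_flows G (int_flows k D) f g)"

end

theory Submission
  imports Defs "HOL-Combinatorics.Cycles"
begin

text \<open>
  Measure the values of a \<open>\<int>\<^sub>4\<close>-flow on the three triangle edges along one direction around the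
  triangle. At each corner the third edge carries the difference of two of these values, so they
  are distinct, and being nonzero they are \<open>1\<close>, \<open>2\<close>, \<open>3\<close> in some order. Thus exactly one triangle
  edge carries the value \<open>2\<close>, whichever way it is oriented. Which edge this is cannot be changed by
  a modification along a cycle \<open>C\<close>:

  \<^item> If \<open>C\<close> contains the whole triangle, then it contains no other edge at a corner. The three
    differences stay the same, so all three values are shifted by the same amount; as they still
    avoid \<open>0\<close>, the shift is \<open>0\<close>.
  \<^item> If \<open>C\<close> contains exactly two triangle edges, then the third value stays the same, and so does
    the difference of the other two. If they were interchanged, their difference would equal its
    negative, hence be \<open>2\<close>; then they are \<open>1\<close> and \<open>3\<close>, and the third value is \<open>2\<close> in both flows.
  \<^item> If \<open>C\<close> contains at most one triangle edge, two of the values and hence all three are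
    unchanged.

  This is \<open>triangle_two_invariant\<close>, transported to graphs by \<open>adjacent_flows_triangle\<close>.

  It remains to find two flows that place the \<open>2\<close> on different triangle edges. In a proper
  3-edge-colouring of a cubic graph, the colours \<open>i\<close> and \<open>j\<close> form a 2-factor all of whose cycles
  are even, and sending one unit around each cycle gives an integer flow \<open>\<phi>\<^bsub>ij\<^esub>\<close> with values
  \<open>\<plusminus>1\<close> on these colours and \<open>0\<close> on the third. Then \<open>\<phi>\<^bsub>ij\<^esub> + 2\<phi>\<^bsub>ik\<^esub>\<close> is a 4-flow
  that is even exactly on the edges of colour \<open>k\<close> (\<open>four_flow_of_colouring\<close>). Choosing \<open>k\<close> as the
  colour of one triangle edge and then of another gives two 4-flows whose reductions modulo 4 are
  not equivalent. Reduction modulo 4 maps adjacent 4-flows to adjacent \<open>\<int>\<^sub>4\<close>-flows, so the two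
  4-flows are not equivalent either.
\<close>

section \<open>Two-colouring the union of two perfect matchings\<close>

text \<open>Two perfect matchings, given as fixed-point-free involutions \<open>\<sigma>\<close> and \<open>\<tau>\<close>, form a bipartite
  graph. Walking along it two steps at a time means iterating \<open>\<pi> = \<tau> \<circ> \<sigma>\<close>, and both \<open>\<sigma> v\<close> and
  \<open>\<tau> v\<close> lie in the same orbit of \<open>\<pi>\<close>. That orbit is not the orbit of \<open>v\<close>: as \<open>\<sigma>\<close> conjugates \<open>\<pi>\<close>
  to its inverse, \<open>\<sigma> v = \<pi>\<^sup>k v\<close> would yield a fixed point of \<open>\<sigma>\<close> or of \<open>\<tau>\<close> in the middle
  of the walk, according to the parity of \<open>k\<close>. So the orbits come in pairs, and \<open>v\<close> is coloured by
  whether its own orbit contains the smaller minimum of the pair in some enumeration of \<open>V\<close>.\<close>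

lemma involutions_two_colouring:
  fixes \<sigma> \<tau> :: "'v \<Rightarrow> 'v"
  assumes fin: "finite V"
    and \<sigma>: "\<And>v. \<sigma> (\<sigma> v) = v" "\<And>v. v \<in> V \<Longrightarrow> \<sigma> v \<in> V" "\<And>v. v \<in> V \<Longrightarrow> \<sigma> v \<noteq> v"
      "\<And>v. v \<notin> V \<Longrightarrow> \<sigma> v = v"
    and \<tau>: "\<And>v. \<tau> (\<tau> v) = v" "\<And>v. v \<in> V \<Longrightarrow> \<tau> v \<in> V" "\<And>v. v \<in> V \<Longrightarrow> \<tau> v \<noteq> v"
      "\<And>v. v \<notin> V \<Longrightarrow> \<tau> v = v"
  shows "\<exists>s :: 'v \<Rightarrow> bool. \<forall>v \<in> V. s (\<sigma> v) \<noteq> s v \<and> s (\<tau> v) \<noteq> s v"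
proof -
  define \<pi> where "\<pi> = \<tau> \<circ> \<sigma>"
  define \<rho> where "\<rho> = \<sigma> \<circ> \<tau>"
  have "\<pi> \<circ> \<rho> = id" and \<rho>\<pi>: "\<rho> \<circ> \<pi> = id"
    by (auto simp: \<pi>_def \<rho>_def \<sigma> \<tau>)
  have "bij \<pi>"
    using \<open>\<pi> \<circ> \<rho> = id\<close> \<rho>\<pi> by (rule o_bij[rotated])
  have "finite {v. \<pi> v \<noteq> v}"
    by (rule finite_subset[OF _ fin]) (auto simp: \<pi>_def, metis \<sigma>(4) \<tau>(4))
  with \<open>bij \<pi>\<close> have "permutation \<pi>"
    by (simp add: permutation)
  then obtain N where N: "\<pi> ^^ N = id" "N > 0"
    using permutation_is_nilpotent by blast
  have pow_V: "(\<pi> ^^ k) v \<in> V" if "v \<in> V" for k v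
    using that by (induction k) (auto simp: \<pi>_def \<sigma> \<tau>)
  have cancel: "(\<rho> ^^ k) ((\<pi> ^^ k) v) = v" for k v
  proof (induction k arbitrary: v)
    case (Suc k)
    have "(\<rho> ^^ Suc k) ((\<pi> ^^ Suc k) v) = (\<rho> ^^ k) ((\<rho> \<circ> \<pi>) ((\<pi> ^^ k) v))"
      by (simp add: funpow_swap1)
    then show ?case
      using Suc by (simp add: \<rho>\<pi>)
  qed simp
  have conj: "\<sigma> ((\<pi> ^^ k) v) = (\<rho> ^^ k) (\<sigma> v)" for k v
    by (induction k) (auto simp: \<pi>_def \<rho>_def \<sigma>)
  \<comment> \<open>the walk from \<open>v\<close> to \<open>\<sigma> v\<close> is its own reverse, so \<open>\<sigma>\<close> or \<open>\<tau>\<close> fixes its midpoint\<close>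
  have no_return: "\<sigma> v \<noteq> (\<pi> ^^ k) v" if "v \<in> V" for k v
  proof
    assume eq: "\<sigma> v = (\<pi> ^^ k) v"
    define j where "j = k div 2"
    define w where "w = (\<pi> ^^ j) v"
    have w: "w \<in> V"
      using pow_V[OF that] by (simp add: w_def)
    show False
    proof (cases "even k")
      case True
      then have "k = j + j" by (auto simp: j_def)
      then have "\<sigma> w = w"
        using eq conj[of j v] cancel[of j w] by (simp add: funpow_add w_def)
      then show False using \<sigma>(3)[OF w] by simp
    next
      case False
      then have "k = j + (1 + j)" by (auto simp: j_def elim: oddE)
      then have "\<sigma> w = \<pi> w"
        using eq conj[of j v] cancel[of j "\<pi> w"] by (simp only: funpow_add w_def) simp
      then show False using \<tau>(3)[OF \<sigma>(2)[OF w]] by (simp add: \<pi>_def)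
    qed
  qed
  define orb where "orb v = range (\<lambda>k. (\<pi> ^^ k) v)" for v
  have orbit_step: "orb (\<pi> v) = orb v" for v
  proof -
    have "(\<pi> ^^ k) (\<pi> v) \<in> orb v" for k
      unfolding orb_def using funpow_swap1[of \<pi> k v] by (auto intro: range_eqI[of _ _ "Suc k"])
    moreover have "(\<pi> ^^ k) v \<in> orb (\<pi> v)" for k
    proof -
      have "v = (\<pi> ^^ N) v" by (simp add: N)
      also have "\<dots> = (\<pi> ^^ (N - 1)) (\<pi> v)"
        using N(2) by (cases N) (auto simp: funpow_swap1)
      finally have "(\<pi> ^^ k) v = (\<pi> ^^ (k + (N - 1))) (\<pi> v)"
        by (simp add: funpow_add)
      then show ?thesis unfolding orb_def by blast
    qed
    ultimately show ?thesis unfolding orb_def by auto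
  qed
  have orbit_pow: "orb ((\<pi> ^^ k) v) = orb v" for k v
    by (induction k) (auto simp: orbit_step)
  have self: "v \<in> orb v" for v
    unfolding orb_def by (rule range_eqI[of _ _ 0]) simp
  have orbit_V: "orb v \<subseteq> V" if "v \<in> V" for v
    unfolding orb_def using pow_V[OF that] by blast
  have disjoint: "orb v \<inter> orb (\<sigma> v) = {}" if "v \<in> V" for v
  proof (rule ccontr)
    assume "orb v \<inter> orb (\<sigma> v) \<noteq> {}"
    then obtain k l where "(\<pi> ^^ k) v = (\<pi> ^^ l) (\<sigma> v)"
      unfolding orb_def by blast
    then have "orb v = orb (\<sigma> v)"
      using orbit_pow[of k v] orbit_pow[of l "\<sigma> v"] by simp
    then have "\<sigma> v \<in> orb v" using self by blast
    then show False using no_return[OF that] unfolding orb_def by blast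
  qed
  obtain idx :: "'v \<Rightarrow> nat" where idx: "inj_on idx V"
    using finite_imp_inj_to_nat_seg[OF fin] by blast
  define m where "m v = Min (idx ` orb v)" for v
  have m_in: "m v \<in> idx ` orb v" if "v \<in> V" for v
    unfolding m_def using finite_subset[OF orbit_V[OF that] fin] self[of v] by (intro Min_in) auto
  have m_neq: "m v \<noteq> m (\<sigma> v)" if v: "v \<in> V" for v
  proof
    assume eq: "m v = m (\<sigma> v)"
    obtain x y where "x \<in> orb v" "y \<in> orb (\<sigma> v)" "idx x = idx y"
      using m_in[OF v] m_in[OF \<sigma>(2)[OF v]] eq by auto
    moreover from this have "x = y"
      using inj_onD[OF idx] orbit_V[OF v] orbit_V[OF \<sigma>(2)[OF v]] by blast
    ultimately show False using disjoint[OF v] by blast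
  qed
  have m_\<tau>: "m (\<tau> v) = m (\<sigma> v)" "m (\<sigma> (\<tau> v)) = m v" for v
  proof -
    have "orb (\<tau> v) = orb (\<sigma> v)" "orb (\<sigma> (\<tau> v)) = orb v"
      using orbit_step[of "\<sigma> v"] orbit_step[of "\<sigma> (\<tau> v)"] by (simp_all add: \<pi>_def \<sigma> \<tau>)
    then show "m (\<tau> v) = m (\<sigma> v)" "m (\<sigma> (\<tau> v)) = m v"
      by (simp_all add: m_def)
  qed
  show ?thesis
  proof (intro exI ballI conjI)
    show "(m (\<sigma> v) < m (\<sigma> (\<sigma> v))) \<noteq> (m v < m (\<sigma> v))" if "v \<in> V" for v
      using m_neq[OF that] by (auto simp: \<sigma>)
    show "(m (\<tau> v) < m (\<sigma> (\<tau> v))) \<noteq> (m v < m (\<sigma> v))" if "v \<in> V" for v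
      using m_neq[OF that] by (auto simp: m_\<tau>)
  qed
qed

section \<open>Three distinct nonzero elements of the integers modulo 4\<close>

lemma Z4_cases: "(x :: 4) = 0 \<or> x = 1 \<or> x = 2 \<or> x = 3"
proof (cases x)
  case (of_int z)
  then have "z \<in> {0, 1, 2, 3}" by auto
  with of_int show ?thesis by auto
qed

lemma Z4_triples:
  fixes p q r :: 4
  assumes "distinct [0, p, q, r]"
  shows "(p, q, r) \<in> {(1,2,3), (1,3,2), (2,1,3), (2,3,1), (3,1,2), (3,2,1)}"
proof -
  have "p \<in> {1, 2, 3}" "q \<in> {1, 2, 3}" "r \<in> {1, 2, 3}"
    using Z4_cases[of p] Z4_cases[of q] Z4_cases[of r] assms by auto
  then show ?thesis using assms by (elim insertE emptyE) simp_all
qed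

text \<open>The values along a triangle before and after a modification along a cycle: at each corner
  the cycle misses one of the two triangle edges or the third edge, whose value is the
  difference.\<close>

lemma triangle_two_invariant:
  fixes p q r p' q' r' :: 4
  assumes "distinct [0, p, q, r]" "distinct [0, p', q', r']"
    and "p = p' \<or> r = r' \<or> p - r = p' - r'"
    and "q = q' \<or> p = p' \<or> q - p = q' - p'"
    and "r = r' \<or> q = q' \<or> r - q = r' - q'"
  shows "p = 2 \<longleftrightarrow> p' = 2"
  using Z4_triples[OF assms(1)] Z4_triples[OF assms(2)] assms(3-5)
  by (elim insertE emptyE; simp)

section \<open>Incidence and outward flow\<close>

definition incident :: "('v, 'e) mgraph \<Rightarrow> 'v \<Rightarrow> 'e set" where
  "incident G v = {e \<in> edges G. v \<in># ends G e}"

definition loopless :: "('v, 'e) mgraph \<Rightarrow> bool" where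
  "loopless G \<longleftrightarrow> (\<forall>e \<in> edges G. \<forall>v. ends G e \<noteq> {#v, v#})"

text \<open>The flow along \<open>e\<close> away from \<open>v\<close>; it does not change if \<open>e\<close> is reversed and \<open>f e\<close> is
  negated. It makes conservation a single sum over the edges at \<open>v\<close> and avoids distinguishing the
  orientations of the edges of a triangle.\<close>

definition outward :: "('v, 'e) pre_digraph \<Rightarrow> ('e \<Rightarrow> 'a::ab_group_add) \<Rightarrow> 'v \<Rightarrow> 'e \<Rightarrow> 'a" where
  "outward D f v e = (if tail D e = v then f e else 0) - (if head D e = v then f e else 0)"

lemma loopless_ends:
  assumes "finite_graph G" "loopless G" "e \<in> edges G" "v \<in># ends G e"
  obtains u where "ends G e = {#v, u#}" "u \<noteq> v" "u \<in> nodes G" "v \<in> nodes G"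
proof -
  have sz: "size (ends G e) = 2" "set_mset (ends G e) \<subseteq> nodes G"
    using assms(1,3) by (auto simp: finite_graph_def)
  obtain M where M: "ends G e = add_mset v M"
    using assms(4) by (meson mset_add)
  with sz have "size M = 1" by simp
  then obtain u where "M = {#u#}" using size_1_singleton_mset by blast
  with M sz assms(2,3) show thesis
    by (intro that[of u]) (auto simp: loopless_def)
qed

lemma degree_loopless:
  assumes "finite_graph G" "loopless G"
  shows "degree G v = card (incident G v)"
proof -
  have "count (ends G e) v = of_bool (v \<in># ends G e)" if "e \<in> edges G" for e
  proof (cases "v \<in># ends G e")
    case True
    then obtain u where "ends G e = {#v, u#}" "u \<noteq> v"
      using loopless_ends[OF assms \<open>e \<in> edges G\<close>] by blast
    then show ?thesis by simp
  qed (simp add: not_in_iff)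
  then have "degree G v = (\<Sum>e \<in> edges G. of_bool (v \<in># ends G e))"
    unfolding degree_def by (intro sum.cong) auto
  also have "\<dots> = card (incident G v)"
    using assms(1) by (simp add: finite_graph_def incident_def Int_def)
  finally show ?thesis .
qed

lemma finite_incident: "finite_graph G \<Longrightarrow> finite (incident G v)"
  by (simp add: finite_graph_def incident_def)

lemma loopless_subgraph: "loopless G \<Longrightarrow> subgraph_of H G \<Longrightarrow> loopless H"
  by (auto simp: loopless_def subgraph_of_def)

lemma incident_subgraph: "subgraph_of H G \<Longrightarrow> incident H v = incident G v \<inter> edges H"
  by (auto simp: incident_def subgraph_of_def)

lemma cycle_misses_edge:
  assumes "loopless G" "cycle_in C G" "distinct [x, y, z]" "incident G v = {x, y, z}"
  shows "x \<notin> edges C \<or> y \<notin> edges C \<or> z \<notin> edges C"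
proof (rule ccontr)
  assume "\<not> ?thesis"
  then have all: "incident C v = {x, y, z}"
    using incident_subgraph[of C G v] assms by (auto simp: cycle_in_def)
  have C: "finite_graph C" "regular 2 C" "loopless C"
    using assms(1,2) loopless_subgraph by (auto simp: cycle_in_def is_cycle_def)
  have "x \<in> incident C v" using all by simp
  then have "v \<in> nodes C"
    using C(1) by (auto simp: incident_def finite_graph_def)
  then have "card (incident C v) = 2"
    using C by (simp add: regular_def degree_loopless)
  with all assms(3) show False by simp
qed

text \<open>A cycle on three vertices could a priori have two parallel edges; these would fill the
  degrees of their ends and leave no edge for the remaining vertex.\<close>

lemma triangle_edges:
  assumes lG: "loopless G" and "contains_cycle_of_length G 3"
  obtains x y z a b c where
    "x \<in> edges G" "y \<in> edges G" "z \<in> edges G" "distinct [x, y, z]"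
    "ends G x = {#a, b#}" "ends G y = {#b, c#}" "ends G z = {#c, a#}"
    "a \<in> nodes G" "b \<in> nodes G" "c \<in> nodes G"
proof -
  obtain T where T: "cycle_in T G" "card (nodes T) = 3"
    using assms(2) by (auto simp: contains_cycle_of_length_def)
  have sub: "subgraph_of T G" and fT: "finite_graph T" and "regular 2 T"
    using T(1) by (auto simp: cycle_in_def is_cycle_def)
  have lT: "loopless T" using loopless_subgraph[OF lG sub] .
  have deg: "card (incident T v) = 2" if "v \<in> nodes T" for v
    using that \<open>regular 2 T\<close> by (simp add: regular_def degree_loopless[OF fT lT])
  have another: "\<exists>e' \<in> incident T v. e' \<noteq> e" if "v \<in> nodes T" for v e
    using deg[OF that] by (auto simp: card_2_iff)
  have only: "e = x \<or> e = y" if "v \<in> nodes T" "e \<in> incident T v" "x \<in> incident T v"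
    "y \<in> incident T v" "x \<noteq> y" for v e x y
    using deg[OF that(1)] that by (auto simp: card_2_iff)
  note ends_T = loopless_ends[OF fT lT]
  obtain a where a: "a \<in> nodes T" using T(2) by fastforce
  obtain x z where xz: "x \<noteq> z" "x \<in> incident T a" "z \<in> incident T a"
    using deg[OF a] by (auto simp: card_2_iff)
  obtain b where b: "ends T x = {#a, b#}" "b \<noteq> a" "b \<in> nodes T"
    using ends_T[of x a] xz by (auto simp: incident_def)
  obtain c where c: "ends T z = {#a, c#}" "c \<noteq> a" "c \<in> nodes T"
    using ends_T[of z a] xz by (auto simp: incident_def)
  have xb: "x \<in> incident T b" and zc: "z \<in> incident T c"
    using b c xz by (auto simp: incident_def)
  have bc: "b \<noteq> c"
  proof
    assume eq: "b = c"
    have "\<exists>d \<in> nodes T. d \<noteq> a \<and> d \<noteq> b"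
    proof (rule ccontr)
      assume "\<not> ?thesis"
      then have "nodes T \<subseteq> {a, b}" by auto
      then have "card (nodes T) \<le> card {a, b}" by (rule card_mono[rotated]) simp
      with T(2) show False by (simp add: card_insert_if split: if_splits)
    qed
    then obtain d where d: "d \<in> nodes T" "d \<noteq> a" "d \<noteq> b" by blast
    have nodes: "nodes T = {a, b, d}"
      using T(2) a b d by (intro card_seteq[symmetric]) (auto intro: card_ge_0_finite)
    obtain e where e: "e \<in> incident T d"
      using another[OF d(1)] by blast
    then obtain u where u: "ends T e = {#d, u#}" "u \<noteq> d" "u \<in> nodes T"
      using ends_T[of e d] by (auto simp: incident_def)
    then have "e \<in> incident T a \<or> e \<in> incident T b"
      using nodes e by (auto simp: incident_def)
    then have "e = x \<or> e = z"
      using only[OF a] only[OF b(3)] xz xb zc eq by blast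
    with u b c eq d show False by (auto simp: add_eq_conv_ex)
  qed
  have nodes: "nodes T = {a, b, c}"
    using T(2) a b c bc by (intro card_seteq[symmetric]) (auto intro: card_ge_0_finite)
  obtain y where y: "y \<in> incident T b" "y \<noteq> x" using another[OF b(3)] by blast
  obtain u where u: "ends T y = {#b, u#}" "u \<noteq> b" "u \<in> nodes T"
    using ends_T[of y b] y by (auto simp: incident_def)
  have "u \<noteq> a"
  proof
    assume "u = a"
    then have "y \<in> incident T a" using u y by (auto simp: incident_def)
    then have "y = z" using only[OF a _ xz(2,3,1)] y by blast
    with u c b bc show False by (auto simp: add_eq_conv_ex)
  qed
  then have y_ends: "ends T y = {#b, c#}" using nodes u by auto
  have "y \<noteq> z" using y_ends c b bc by (auto simp: add_eq_conv_ex)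
  show thesis
  proof (rule that[of x y z a b c])
    show "x \<in> edges G" "y \<in> edges G" "z \<in> edges G"
      "a \<in> nodes G" "b \<in> nodes G" "c \<in> nodes G"
      using sub xz y a b c by (auto simp: subgraph_of_def incident_def)
    show "distinct [x, y, z]"
      using xz y \<open>y \<noteq> z\<close> by auto
    show "ends G x = {#a, b#}" "ends G y = {#b, c#}" "ends G z = {#c, a#}"
      using sub xz y b c y_ends by (auto simp: subgraph_of_def incident_def)
  qed
qed

section \<open>Flows on an oriented cubic graph\<close>

locale oriented_cubic_graph =
  fixes G :: "('v, 'e) mgraph" and D :: "('v, 'e) pre_digraph"
  assumes fin: "finite_graph G" and cub: "cubic G" and loopless: "loopless G"
    and ori: "orientation G D"
begin

lemma verts_D [simp]: "verts D = nodes G" and arcs_D [simp]: "arcs D = edges G"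
  using ori by (auto simp: orientation_def)

lemma ends_D: "e \<in> edges G \<Longrightarrow> ends G e = {#tail D e, head D e#}"
  using ori by (auto simp: orientation_def)

lemma tail_neq_head: "e \<in> edges G \<Longrightarrow> tail D e \<noteq> head D e"
  using ends_D[of e] loopless by (auto simp: loopless_def)

lemma incident_D: "incident G v = {e \<in> edges G. tail D e = v \<or> head D e = v}"
  by (auto simp: incident_def ends_D)

lemma ends_nodes: "e \<in> edges G \<Longrightarrow> tail D e \<in> nodes G \<and> head D e \<in> nodes G"
  using fin ends_D[of e] by (auto simp: finite_graph_def)

lemma card_incident: "v \<in> nodes G \<Longrightarrow> card (incident G v) = 3"
  using cub by (simp add: regular_def degree_loopless[OF fin loopless])

lemma conserved_iff:
  "conserved D f \<longleftrightarrow> (\<forall>v \<in> nodes G. (\<Sum>e \<in> incident G v. outward D f v e) = 0)"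
proof -
  have "(\<Sum>e \<in> incident G v. outward D f v e) =
      (\<Sum>e \<in> out_arcs D v. f e) - (\<Sum>e \<in> in_arcs D v. f e)" for v
  proof -
    have fi: "finite (edges G)" using fin by (simp add: finite_graph_def)
    have "(\<Sum>e \<in> incident G v. outward D f v e) = (\<Sum>e \<in> edges G. outward D f v e)"
      using fi by (intro sum.mono_neutral_left) (auto simp: incident_D outward_def)
    also have "\<dots> = (\<Sum>e \<in> edges G. if tail D e = v then f e else 0)
        - (\<Sum>e \<in> edges G. if head D e = v then f e else 0)"
      unfolding outward_def by (rule sum_subtractf)
    also have "\<dots> = (\<Sum>e \<in> out_arcs D v. f e) - (\<Sum>e \<in> in_arcs D v. f e)"
      using fi by (simp add: out_arcs_def in_arcs_def sum.inter_filter)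
    finally show ?thesis .
  qed
  then show ?thesis by (simp add: conserved_def)
qed

lemma outward_other_end:
  assumes "e \<in> edges G" "ends G e = {#u, v#}"
  shows "outward D f v e = - outward D f u e"
  using ends_D[OF assms(1)] assms(2) tail_neq_head[OF assms(1)]
  by (auto simp: outward_def add_eq_conv_ex)

lemma outward_incident:
  assumes "e \<in> incident G v"
  shows "outward D f v e = f e \<or> outward D f v e = - f e"
  using assms tail_neq_head[of e] by (auto simp: incident_D outward_def)

lemma third_edge:
  assumes "v \<in> nodes G" "x \<in> incident G v" "y \<in> incident G v" "x \<noteq> y"
  obtains z where "distinct [x, y, z]" "incident G v = {x, y, z}"
proof -
  have "card (incident G v - {x, y}) = 1"
    using card_incident[OF assms(1)] assms by (simp add: card_Diff_subset)
  then obtain z where "incident G v - {x, y} = {z}" by (auto simp: card_1_singleton_iff)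
  then show thesis using assms that[of z] by auto
qed

text \<open>Here \<open>y\<close> runs into the corner \<open>v\<close> of the triangle and \<open>x\<close> out of it, both measured along
  the triangle. By conservation the third edge at \<open>v\<close> carries the difference of the two values.
  This difference is therefore nonzero; and since a cycle cannot use all three edges at \<open>v\<close>, at
  least one of the two values and their difference is the same for adjacent flows.\<close>

lemma flow_at_corner:
  fixes f g :: "'e \<Rightarrow> 'a::ab_group_add"
  assumes f: "f \<in> group_flows D" and v: "v \<in> nodes G"
    and xy: "x \<in> edges G" "y \<in> edges G" "x \<noteq> y" "ends G x = {#v, w#}" "ends G y = {#u, v#}"
  shows "outward D f v x \<noteq> outward D f u y"
    and "g \<in> group_flows D \<Longrightarrow> adjacent_flows G f g \<Longrightarrow>
      outward D f v x = outward D g v x \<or> outward D f u y = outward D g u y \<or>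
      outward D f v x - outward D f u y = outward D g v x - outward D g u y"
proof -
  have inc: "x \<in> incident G v" "y \<in> incident G v"
    using xy by (auto simp: incident_def)
  obtain z where z: "distinct [x, y, z]" "incident G v = {x, y, z}"
    using third_edge[OF v inc \<open>x \<noteq> y\<close>] .
  have balance: "outward D h v x - outward D h u y = - outward D h v z"
    if "h \<in> group_flows D" for h :: "'e \<Rightarrow> 'a"
  proof -
    have "(\<Sum>e \<in> incident G v. outward D h v e) = 0"
      using that v by (simp add: group_flows_def conserved_iff)
    then have "(\<Sum>e \<in> {x, y, z}. outward D h v e) = 0"
      by (simp only: z(2))
    with z(1) have "outward D h v x + (outward D h v y + outward D h v z) = 0"
      by simp
    moreover have "outward D h v y = - outward D h u y"
      by (rule outward_other_end[OF xy(2,5)])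
    ultimately show ?thesis
      by (simp add: eq_neg_iff_add_eq_0 add_diff_eq diff_add_eq)
  qed
  have "z \<in> edges G" "z \<in> incident G v" using z(2) by (auto simp: incident_def)
  then have "outward D f v z \<noteq> 0"
    using outward_incident[of z v f] f by (auto simp: group_flows_def PiE_def Pi_def)
  then show "outward D f v x \<noteq> outward D f u y"
    using balance[OF f] by auto
  assume g: "g \<in> group_flows D" and "adjacent_flows G f g"
  then obtain C where C: "cycle_in C G" "\<And>e. e \<in> edges G - edges C \<Longrightarrow> f e = g e"
    by (auto simp: adjacent_flows_def)
  have same: "outward D f w' e = outward D g w' e" if "e \<in> edges G" "e \<notin> edges C" for e w'
    using C(2)[of e] that by (simp add: outward_def)
  from cycle_misses_edge[OF loopless C(1) z]
  show "outward D f v x = outward D g v x \<or> outward D f u y = outward D g u y \<or>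
      outward D f v x - outward D f u y = outward D g v x - outward D g u y"
    using same[OF xy(1), of v] same[OF xy(2), of u] same[OF \<open>z \<in> edges G\<close>, of v]
      balance[OF f] balance[OF g] by auto
qed

lemma adjacent_flows_triangle:
  fixes f g :: "'e \<Rightarrow> 4"
  assumes f: "f \<in> group_flows D" and g: "g \<in> group_flows D" and adj: "adjacent_flows G f g"
    and xyz: "x \<in> edges G" "y \<in> edges G" "z \<in> edges G" "distinct [x, y, z]"
      "ends G x = {#a, b#}" "ends G y = {#b, c#}" "ends G z = {#c, a#}"
    and abc: "a \<in> nodes G" "b \<in> nodes G" "c \<in> nodes G"
  shows "f x = 2 \<longleftrightarrow> g x = 2"
proof -
  have "x \<noteq> z" "y \<noteq> x" "z \<noteq> y"
    using xyz(4) by auto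
  let ?p = "\<lambda>h. outward D h a x" and ?q = "\<lambda>h. outward D h b y" and ?r = "\<lambda>h. outward D h c z"
  have inc: "x \<in> incident G a" "y \<in> incident G b" "z \<in> incident G c"
    using xyz by (auto simp: incident_def)
  have dist: "distinct [0, ?p h, ?q h, ?r h]" if h: "h \<in> group_flows D" for h :: "'e \<Rightarrow> 4"
  proof -
    have "?p h \<noteq> 0" "?q h \<noteq> 0" "?r h \<noteq> 0"
      using h inc xyz outward_incident[of _ _ h] by (auto simp: group_flows_def PiE_def Pi_def) (metis neg_equal_0_iff_equal)+
    then show ?thesis
      using flow_at_corner(1)[OF h abc(1) xyz(1,3) \<open>x \<noteq> z\<close> xyz(5,7)]
        flow_at_corner(1)[OF h abc(2) xyz(2,1) \<open>y \<noteq> x\<close> xyz(6,5)]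
        flow_at_corner(1)[OF h abc(3) xyz(3,2) \<open>z \<noteq> y\<close> xyz(7,6)] by auto
  qed
  \<comment> \<open>\<open>2 = -2\<close>, so the direction in which the edge is traversed is irrelevant\<close>
  have two: "?p h = 2 \<longleftrightarrow> h x = 2" for h :: "'e \<Rightarrow> 4"
    using outward_incident[OF inc(1), of h] Z4_cases[of "h x"] by auto
  have "?p f = 2 \<longleftrightarrow> ?p g = 2"
    using dist[OF f] dist[OF g]
      flow_at_corner(2)[OF f abc(1) xyz(1,3) \<open>x \<noteq> z\<close> xyz(5,7) g adj]
      flow_at_corner(2)[OF f abc(2) xyz(2,1) \<open>y \<noteq> x\<close> xyz(6,5) g adj]
      flow_at_corner(2)[OF f abc(3) xyz(3,2) \<open>z \<noteq> y\<close> xyz(7,6) g adj]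
    by (rule triangle_two_invariant)
  then show ?thesis by (simp add: two)
qed

section \<open>Flows from edge colourings\<close>

definition proper_3_colouring :: "('e \<Rightarrow> nat) \<Rightarrow> bool" where
  "proper_3_colouring c \<longleftrightarrow> (\<forall>e \<in> edges G. c e < 3) \<and> (\<forall>v. inj_on c (incident G v))"

text \<open>Three edges at a vertex with distinct colours exhaust the three colours.\<close>

lemma colour_class_perfect_matching:
  assumes "proper_3_colouring c" and v: "v \<in> nodes G" and k: "k < 3"
  shows "\<exists>!e. e \<in> incident G v \<and> c e = k"
proof -
  have inj: "inj_on c (incident G v)" and "c ` incident G v \<subseteq> {..<3}"
    using assms(1) by (auto simp: proper_3_colouring_def incident_def)
  moreover have "card (c ` incident G v) = card {..<3::nat}"
    using inj card_incident[OF v] by (simp add: card_image)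
  ultimately have "c ` incident G v = {..<3}"
    by (intro card_subset_eq) auto
  with k have "k \<in> c ` incident G v" by simp
  then show ?thesis using inj by (auto dest: inj_onD)
qed

text \<open>A two-colouring of the vertices that alternates along the edges of colours \<open>i\<close> and \<open>j\<close>
  orients the cycles formed by them consistently: colour \<open>i\<close> carries a unit from the first class
  to the second, and colour \<open>j\<close> carries it back.\<close>

lemma signed_flow_of_two_colours:
  fixes c :: "'e \<Rightarrow> nat"
  assumes c: "proper_3_colouring c"
    and ij: "i < 3" "j < 3" "i \<noteq> j"
  obtains \<phi> :: "'e \<Rightarrow> int" where "conserved D \<phi>"
    "\<And>e. e \<in> edges G \<Longrightarrow> c e \<in> {i, j} \<Longrightarrow> \<bar>\<phi> e\<bar> = 1"
    "\<And>e. e \<in> edges G \<Longrightarrow> c e \<notin> {i, j} \<Longrightarrow> \<phi> e = 0"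
proof -
  define M where "M k v = (THE e. e \<in> incident G v \<and> c e = k)" for k v
  have M: "M k v \<in> incident G v" "c (M k v) = k" if "v \<in> nodes G" "k < 3" for k v
    using theI'[OF colour_class_perfect_matching[OF c that]] by (auto simp: M_def)
  have M_eq: "M k v = e" if "v \<in> nodes G" "k < 3" "e \<in> incident G v" "c e = k" for k v e
    using colour_class_perfect_matching[OF c that(1,2)] M[OF that(1,2)] that by blast
  define partner where "partner k v =
    (if v \<in> nodes G then if tail D (M k v) = v then head D (M k v) else tail D (M k v) else v)"
    for k v
  have partner: "partner k v \<in> nodes G" "partner k v \<noteq> v" "partner k (partner k v) = v"
    if v: "v \<in> nodes G" and k: "k < 3" for k v
  proof -
    have e: "M k v \<in> edges G" "tail D (M k v) = v \<or> head D (M k v) = v"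
      using M[OF that] by (auto simp: incident_D)
    then show n: "partner k v \<in> nodes G" and "partner k v \<noteq> v"
      using ends_nodes[OF e(1)] tail_neq_head[OF e(1)] v by (auto simp: partner_def)
    have "M k (partner k v) = M k v"
      by (rule M_eq[OF n k]) (use e v M[OF that] in \<open>auto simp: incident_D partner_def\<close>)
    then show "partner k (partner k v) = v"
      using n e v tail_neq_head[OF e(1)] by (auto simp: partner_def)
  qed
  have partner_edge: "partner (c e) (tail D e) = head D e"
    if "e \<in> edges G" "c e < 3" for e
  proof -
    have "M (c e) (tail D e) = e"
      using that ends_nodes by (intro M_eq) (auto simp: incident_D)
    then show ?thesis using that ends_nodes by (auto simp: partner_def)
  qed
  have invol: "partner k (partner k v) = v" if "k < 3" for k v
    using partner(3)[of v k] that by (cases "v \<in> nodes G") (auto simp: partner_def)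
  have fin_nodes: "finite (nodes G)" using fin by (simp add: finite_graph_def)
  have outside: "partner k v = v" if "v \<notin> nodes G" for k v
    using that by (simp add: partner_def)
  have "\<exists>s :: 'v \<Rightarrow> bool. \<forall>v \<in> nodes G. s (partner i v) \<noteq> s v \<and> s (partner j v) \<noteq> s v"
    by (rule involutions_two_colouring[of "nodes G" "partner i" "partner j"])
      (simp_all add: fin_nodes partner invol outside ij)
  then obtain s :: "'v \<Rightarrow> bool" where s: "\<And>v. v \<in> nodes G \<Longrightarrow> s (partner i v) \<noteq> s v"
    "\<And>v. v \<in> nodes G \<Longrightarrow> s (partner j v) \<noteq> s v"
    by blast
  have flip: "s (head D e) \<noteq> s (tail D e)" if "e \<in> edges G" "c e \<in> {i, j}" for e
    using s[of "tail D e"] partner_edge[of e] ends_nodes[of e] that ij by auto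
  define sgn where "sgn v = (if s v then 1 else - 1 :: int)" for v
  define \<phi> where "\<phi> e = (if c e = i then sgn (tail D e) else if c e = j then - sgn (tail D e) else 0)"
    for e
  have "(\<Sum>e \<in> incident G v. outward D \<phi> v e) = 0" if v: "v \<in> nodes G" for v
  proof -
    have zero: "outward D \<phi> v e = 0" if "e \<in> incident G v - {M i v, M j v}" for e
      using that M_eq[OF v ij(1), of e] M_eq[OF v ij(2), of e]
      by (auto simp: outward_def \<phi>_def)
    have neq: "M i v \<noteq> M j v" using M[OF v] ij by metis
    have "outward D \<phi> v (M i v) = sgn v"
      using M[OF v ij(1)] flip[of "M i v"] tail_neq_head[of "M i v"]
      by (auto simp: outward_def \<phi>_def sgn_def incident_D)
    moreover have "outward D \<phi> v (M j v) = - sgn v"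
      using M[OF v ij(2)] ij flip[of "M j v"] tail_neq_head[of "M j v"]
      by (auto simp: outward_def \<phi>_def sgn_def incident_D)
    moreover have "(\<Sum>e \<in> incident G v. outward D \<phi> v e) = (\<Sum>e \<in> {M i v, M j v}. outward D \<phi> v e)"
      using zero M[OF v] ij finite_incident[OF fin, of v] by (intro sum.mono_neutral_right) auto
    ultimately show ?thesis using neq by simp
  qed
  then have "conserved D \<phi>" by (simp add: conserved_iff)
  then show thesis
    by (rule that) (auto simp: \<phi>_def sgn_def)
qed

text \<open>The flow \<open>\<phi> + 2 * \<psi>\<close>, where \<open>\<phi>\<close> has support on the colours \<open>i\<close>, \<open>j\<close> and \<open>\<psi>\<close> on \<open>i\<close>, \<open>k\<close>,
  takes the values \<open>\<plusminus>1 \<plusminus> 2\<close>, \<open>\<plusminus>1\<close> and \<open>\<plusminus>2\<close> on the colours \<open>i\<close>, \<open>j\<close> and \<open>k\<close>.\<close>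

lemma four_flow_of_colouring:
  fixes c :: "'e \<Rightarrow> nat"
  assumes c: "proper_3_colouring c" and k: "k < 3"
  obtains f where "f \<in> int_flows 4 D" "\<And>e. e \<in> edges G \<Longrightarrow> even (f e) \<longleftrightarrow> c e = k"
proof -
  define i where "i = (if k = 0 then 1 else 0 :: nat)"
  define j where "j = 3 - i - k"
  have ij: "i < 3" "j < 3" "i \<noteq> j" "i \<noteq> k" "j \<noteq> k"
    and all: "\<And>l. l < 3 \<Longrightarrow> l = i \<or> l = j \<or> l = k"
    using k by (auto simp: i_def j_def split: if_splits) presburger+
  have bound: "c e < 3" if "e \<in> edges G" for e
    using c that by (simp add: proper_3_colouring_def)
  obtain \<phi> :: "'e \<Rightarrow> int" where \<phi>: "conserved D \<phi>"
    "\<And>e. e \<in> edges G \<Longrightarrow> c e \<in> {i, j} \<Longrightarrow> \<bar>\<phi> e\<bar> = 1"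
    "\<And>e. e \<in> edges G \<Longrightarrow> c e \<notin> {i, j} \<Longrightarrow> \<phi> e = 0"
    using signed_flow_of_two_colours[OF c ij(1-3)] by blast
  obtain \<psi> :: "'e \<Rightarrow> int" where \<psi>: "conserved D \<psi>"
    "\<And>e. e \<in> edges G \<Longrightarrow> c e \<in> {i, k} \<Longrightarrow> \<bar>\<psi> e\<bar> = 1"
    "\<And>e. e \<in> edges G \<Longrightarrow> c e \<notin> {i, k} \<Longrightarrow> \<psi> e = 0"
    using signed_flow_of_two_colours[OF c ij(1) k ij(4)] by blast
  define f where "f = restrict (\<lambda>e. \<phi> e + 2 * \<psi> e) (edges G)"
  have val: "0 < \<bar>f e\<bar> \<and> \<bar>f e\<bar> < 4 \<and> (even (f e) \<longleftrightarrow> c e = k)" if e: "e \<in> edges G" for e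
  proof -
    have f_e: "f e = \<phi> e + 2 * \<psi> e" using e by (simp add: f_def)
    consider "c e = i" | "c e = j" | "c e = k" using all[OF bound[OF e]] by blast
    then show ?thesis
    proof cases
      case 1
      then have "\<bar>\<phi> e\<bar> = 1" "\<bar>\<psi> e\<bar> = 1" using \<phi>(2)[OF e] \<psi>(2)[OF e] by auto
      then have "\<phi> e = 1 \<or> \<phi> e = - 1" "\<psi> e = 1 \<or> \<psi> e = - 1" by linarith+
      then show ?thesis using f_e 1 ij by auto
    next
      case 2
      then have "\<bar>\<phi> e\<bar> = 1" "\<psi> e = 0" using \<phi>(2)[OF e] \<psi>(3)[OF e] ij by auto
      then have "\<phi> e = 1 \<or> \<phi> e = - 1" "\<psi> e = 0" by linarith+
      then show ?thesis using f_e 2 ij by auto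
    next
      case 3
      then have "\<phi> e = 0" "\<bar>\<psi> e\<bar> = 1" using \<phi>(3)[OF e] \<psi>(2)[OF e] ij by auto
      then have "\<phi> e = 0" "\<psi> e = 1 \<or> \<psi> e = - 1" by linarith+
      then show ?thesis using f_e 3 by auto
    qed
  qed
  have out: "outward D f v e = outward D \<phi> v e + 2 * outward D \<psi> v e" if "e \<in> incident G v" for v e
    using that by (auto simp: f_def outward_def incident_def)
  have "conserved D f"
    using \<phi>(1) \<psi>(1) out
    by (simp add: conserved_iff sum.distrib sum_distrib_left[symmetric])
  moreover have "f \<in> edges G \<rightarrow>\<^sub>E {i. 0 < \<bar>i\<bar> \<and> \<bar>i\<bar> < int 4}"
    using val by (auto simp: f_def)
  ultimately have "f \<in> int_flows 4 D" by (simp add: int_flows_def)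
  then show thesis using val that by blast
qed

section \<open>Reduction modulo 4 and inequivalent flows\<close>

definition mod4 :: "('e \<Rightarrow> int) \<Rightarrow> 'e \<Rightarrow> 4" where
  "mod4 f = restrict (\<lambda>e. of_int (f e)) (edges G)"

lemma four_flow_values:
  assumes "f \<in> int_flows 4 D" "e \<in> edges G"
  shows "mod4 f e \<noteq> 0" and "mod4 f e = 2 \<longleftrightarrow> even (f e)"
proof -
  have "0 < \<bar>f e\<bar>" "\<bar>f e\<bar> < 4"
    using assms by (auto simp: int_flows_def PiE_def Pi_def)
  then have "f e \<in> {-3, -2, -1, 1, 2, 3}" by auto
  then show "mod4 f e \<noteq> 0" and "mod4 f e = 2 \<longleftrightarrow> even (f e)"
    using assms(2) by (auto simp: mod4_def)
qed

lemma mod4_flow: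
  assumes "f \<in> int_flows 4 D"
  shows "mod4 f \<in> group_flows D"
proof -
  have out: "outward D (mod4 f) v e = of_int (outward D f v e)" if "e \<in> incident G v" for v e
    using that by (auto simp: mod4_def outward_def incident_def)
  have "conserved D f" using assms by (simp add: int_flows_def)
  then have "conserved D (mod4 f)"
    using out by (simp add: conserved_iff of_int_sum[symmetric] del: of_int_sum)
  then show ?thesis
    using four_flow_values(1)[OF assms] by (auto simp: group_flows_def mod4_def)
qed

lemma mod4_equivalent:
  assumes "equivalent_flows G (int_flows 4 D) f g"
  shows "equivalent_flows G (group_flows D) (mod4 f) (mod4 g)"
  using assms unfolding equivalent_flows_def
proof (induction rule: rtrancl_induct)
  case (step g h)
  then have "mod4 g \<in> group_flows D" "mod4 h \<in> group_flows D" "adjacent_flows G (mod4 g) (mod4 h)"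
    using mod4_flow by (auto simp: adjacent_flows_def mod4_def)
  with step.IH show ?case
    by (auto intro: rtrancl_into_rtrancl)
qed simp

text \<open>The 4-flows that are even exactly on the colours of two different triangle edges.\<close>

lemma inequivalent_flows:
  assumes "edge_colourable 3 G" "contains_cycle_of_length G 3"
  obtains f g where "f \<in> int_flows 4 D" "g \<in> int_flows 4 D"
    "\<not> equivalent_flows G (group_flows D) (mod4 f) (mod4 g)"
proof -
  obtain c :: "'e \<Rightarrow> nat" where bound: "\<And>e. e \<in> edges G \<Longrightarrow> c e < 3"
    and proper: "\<And>e e'. e \<in> edges G \<Longrightarrow> e' \<in> edges G \<Longrightarrow> e \<noteq> e' \<Longrightarrow>
      set_mset (ends G e) \<inter> set_mset (ends G e') \<noteq> {} \<Longrightarrow> c e \<noteq> c e'"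
    using assms(1) unfolding edge_colourable_def by blast
  have c: "proper_3_colouring c"
    using bound proper unfolding proper_3_colouring_def inj_on_def incident_def by blast
  obtain x y z a b d where
    xyz: "x \<in> edges G" "y \<in> edges G" "z \<in> edges G" "distinct [x, y, z]"
      "ends G x = {#a, b#}" "ends G y = {#b, d#}" "ends G z = {#d, a#}"
    and abd: "a \<in> nodes G" "b \<in> nodes G" "d \<in> nodes G"
    using triangle_edges[OF loopless assms(2)] by metis
  have "c x \<noteq> c y"
    using proper[of x y] xyz by auto
  obtain f where f: "f \<in> int_flows 4 D" "\<And>e. e \<in> edges G \<Longrightarrow> even (f e) \<longleftrightarrow> c e = c x"
    using four_flow_of_colouring[OF c bound[OF xyz(1)]] by blast
  obtain g where g: "g \<in> int_flows 4 D" "\<And>e. e \<in> edges G \<Longrightarrow> even (g e) \<longleftrightarrow> c e = c y"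
    using four_flow_of_colouring[OF c bound[OF xyz(2)]] by blast
  have invariant: "f' x = 2 \<longleftrightarrow> g' x = 2"
    if "equivalent_flows G (group_flows D) f' g'" for f' g' :: "'e \<Rightarrow> 4"
    using that unfolding equivalent_flows_def
  proof (induction rule: rtrancl_induct)
    case (step g' h')
    then show ?case
      using adjacent_flows_triangle[OF _ _ _ xyz abd] by blast
  qed simp
  have "mod4 f x = 2" "mod4 g x \<noteq> 2"
    using four_flow_values(2) f g xyz(1) \<open>c x \<noteq> c y\<close> by auto
  then have "\<not> equivalent_flows G (group_flows D) (mod4 f) (mod4 g)"
    using invariant by blast
  then show thesis using that f g by blast
qed

end

theorem theorem3p3:
  fixes G :: "('v, 'e) mgraph" and D :: "('v, 'e) pre_digraph"
  assumes "finite_graph G"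
    and "cubic G"
    and "edge_colourable 3 G"
    and "contains_cycle_of_length G 3"
    and "orientation G D"
  shows "\<not> group_flow_connected TYPE(4) G D \<and> \<not> int_flow_connected 4 G D"
proof -
  have "loopless G"
    using assms(3) by (simp add: edge_colourable_def loopless_def)
  with assms interpret oriented_cubic_graph G D
    by unfold_locales
  obtain f g where fg: "f \<in> int_flows 4 D" "g \<in> int_flows 4 D"
    "\<not> equivalent_flows G (group_flows D) (mod4 f) (mod4 g)"
    using inequivalent_flows[OF assms(3,4)] by blast
  then show ?thesis
    using mod4_flow mod4_equivalent
    unfolding group_flow_connected_def int_flow_connected_def by blast
qed

end
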